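(* Let $A\in\mathbb{R}^{n\times n}$, and let $\mathcal{C_L}=\{x\in\mathbb{R}^n : x^TQx\le 0,\ x^TQu_n\le 0\}$ be a Lorenz cone, where $Q\in\mathbb{R}^{n\times n}$ is a symmetric matrix with inertia $\{n-1,0,1\}$ and $u_n$ is an eigenvector of $Q$ for its negative eigenvalue. Assume that $\mathcal{C_L}$ is an invariant set for the continuous system $\dot{x}(t)=Ax(t)$, and let $x_k\in\mathcal{C_L}$. Then there exists $\tau(x_k)>0$ such that $x_{k+1}\in\mathcal{C_L}$ for all $\Delta t\in[0,\tau(x_k)]$, where $x_{k+1}=(I-\Delta t A)^{-1}x_k$ is obtained by the backward Euler method.
   Context: Inertia $\{n-1,0,1\}$ means that $Q$ has $n-1$ positive eigenvalues, no zero eigenvalue, and exactly one negative eigenvalue. A set $\mathcal{S}$ is an invariant set for $\dot x(t)=Ax(t)$ if $x(0)\in\mathcal{S}$ implies $x(t)\in\mathcal{S}$ for all $t\ge0$. A statement about $x_{k+1}=(I-\Delta t A)^{-1}x_k$ is understood to include that $I-\Delta t A$ is nonsingular. *)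

theory Defs
  imports "HOL-Analysis.Analysis" "HOL-Computational_Algebra.Polynomial"
begin

definition charpoly :: "real^'n^'n \<Rightarrow> real poly" where
  "charpoly Q = det (mat [:0, 1:] - map_matrix (\<lambda>c. [:c:]) Q)"

text \<open>
  The numbers of positive, zero and negative eigenvalues, in this order, counted with (algebraic)
  multiplicity. Only real roots of the characteristic polynomial are counted, so this is the
  usual inertia when \<open>Q\<close> is symmetric.
\<close>

definition inertia :: "real^'n^'n \<Rightarrow> nat \<times> nat \<times> nat" where
  "inertia Q =
     (size (filter_mset (\<lambda>l. l > 0) (proots (charpoly Q))),
      size (filter_mset (\<lambda>l. l = 0) (proots (charpoly Q))),
      size (filter_mset (\<lambda>l. l < 0) (proots (charpoly Q))))"

definition lorenz_cone :: "real^'n^'n \<Rightarrow> real^'n \<Rightarrow> (real^'n) set" where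
  "lorenz_cone Q u = {x. x \<bullet> (Q *v x) \<le> 0 \<and> x \<bullet> (Q *v u) \<le> 0}"

definition solves_linear_ode :: "real^'n^'n \<Rightarrow> (real \<Rightarrow> real^'n) \<Rightarrow> bool" where
  "solves_linear_ode A x \<longleftrightarrow>
     (\<forall>t\<ge>0. (x has_vector_derivative A *v x t) (at t within {0..}))"

definition invariant_continuous :: "real^'n^'n \<Rightarrow> (real^'n) set \<Rightarrow> bool" where
  "invariant_continuous A S \<longleftrightarrow>
     (\<forall>x. solves_linear_ode A x \<longrightarrow> x 0 \<in> S \<longrightarrow> (\<forall>t\<ge>0. x t \<in> S))"

text \<open>
  \<open>matrix_inv\<close> is only meaningful on invertible matrices; nonsingularity of
  the matrix has to be stated separately wherever this step is used.
\<close>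

definition backward_euler_step :: "real^'n^'n \<Rightarrow> real \<Rightarrow> real^'n \<Rightarrow> real^'n" where
  "backward_euler_step A dt x = matrix_inv (mat 1 - dt *\<^sub>R A) *v x"

end

theory Submission
  imports Defs
begin

text \<open>
  An invariant cone of a linear differential equation is invariant under the backward Euler step
  for every step size below the reciprocal of the operator norm of \<open>A\<close>, so the bound \<open>\<tau>\<close> need not
  depend on the starting point. Only two properties of the Lorenz cone matter: it is closed, and
  it is a convex cone.

  \<^emph>\<open>Invariance under the step.\<close> Suppose that \<open>y - dt *\<^sub>R (A *v y)\<close> lies in a closed convex cone \<open>C\<close> and
  \<open>y\<close> does not. Let \<open>p\<close> be the point of \<open>C\<close> closest to \<open>y\<close> and \<open>n = y - p\<close>. Then \<open>n\<close> is nonpositive on \<open>C\<close>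
  and orthogonal to \<open>p\<close>. The trajectory that starts at \<open>p\<close> stays in \<open>C\<close>, so its inner product with \<open>n\<close>
  is \<open>0\<close> at time \<open>0\<close> and never positive afterwards; its derivative at \<open>0\<close> gives \<open>n \<bullet> (A *v p) \<le> 0\<close>
  (\<open>invariant_imp_cross_nonpos\<close>). Substituting \<open>y = p + n\<close> yields
  \<open>n \<bullet> (y - dt *\<^sub>R (A *v y)) \<ge> (1 - dt * onorm ((*v) A)) * (n \<bullet> n) > 0\<close>, which contradicts the sign of
  \<open>n\<close> on \<open>C\<close> (\<open>resolvent_preserves_cone\<close>). This argument needs a trajectory through each point,
  which the exponential series provides (\<open>ex_linear_ode_solution\<close>).

  \<^emph>\<open>Convexity.\<close> The quadratic form of \<open>Q\<close> is positive definite on the orthogonal complement of \<open>u\<close>: a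
  minimiser of the form on the unit sphere of that complement is an eigenvector, and if its
  eigenvalue were nonpositive, then it and \<open>u\<close> together would force two nonpositive roots on the
  characteristic polynomial, one more than the inertia permits
  (\<open>pos_def_on_orthogonal_complement\<close>). A reverse Cauchy--Schwarz argument then shows that
  \<open>x \<bullet> (Q *v y) \<le> 0\<close> for all \<open>x\<close> and \<open>y\<close> in the cone, so the cone is closed under addition
  (\<open>convex_cone_lorenz_cone\<close>).
\<close>

section \<open>Eigenvectors and the characteristic polynomial\<close>

lemma sum_const_poly:
  fixes g :: "'b \<Rightarrow> 'a::comm_ring_1"
  shows "(\<Sum>x\<in>S. [:g x:]) = [:sum g S:]"
  by (induction S rule: infinite_finite_induct) auto

lemma prod_const_poly:
  fixes g :: "'b \<Rightarrow> 'a::comm_ring_1"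
  shows "(\<Prod>x\<in>S. [:g x:]) = [:prod g S:]"
  by (induction S rule: infinite_finite_induct) (auto simp: one_pCons mult.commute)

lemma det_const_poly:
  fixes P :: "'a::comm_ring_1^'n^'n"
  shows "det (map_matrix (\<lambda>c. [:c:]) P) = [:det P:]"
  by (simp add: det_def prod_const_poly sum_const_poly of_int_poly mult.commute)

text \<open>
  This bounds algebraic multiplicities from below by geometric ones. Extend the eigenvectors to a
  basis and let its members be the rows of \<open>P\<close>. In the product of \<open>P\<close> with the transpose of \<open>X - Q\<close>, the
  row that belongs to an eigenvector \<open>v\<close> has the factor \<open>X - l v\<close>, and these factors come out of the
  determinant; \<open>det P\<close> is a nonzero constant.
\<close>

lemma eigenvalue_prod_dvd_charpoly:
  fixes Q :: "real^'n^'n"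
  assumes "independent S" and eig: "\<And>v. v \<in> S \<Longrightarrow> Q *v v = l v *\<^sub>R v"
  shows "(\<Prod>v\<in>S. [:- l v, 1:]) dvd charpoly Q"
proof -
  obtain B where SB: "S \<subseteq> B" and B: "independent B" "UNIV \<subseteq> span B"
    using maximal_independent_subset_extend[OF subset_UNIV assms(1)] by metis
  have finB: "finite B" using B(1) by (rule independent_imp_finite)
  have "card B = CARD('n)"
    using basis_card_eq_dim[OF subset_UNIV B(2,1)] by simp
  then obtain f :: "'n \<Rightarrow> _" where f: "bij_betw f UNIV B"
    using finite_same_card_bij[OF finite finB, of UNIV] by auto
  define P :: "real^'n^'n" where "P = (\<chi> k. f k)"
  have "x = 0" if "P *v x = 0" for x
  proof -
    have "f k \<bullet> x = 0" for k
      using arg_cong[OF that, of "\<lambda>y. y $ k"]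
      by (simp add: P_def matrix_vector_mul_component)
    then have "\<forall>y\<in>B. orthogonal x y"
      using f by (auto simp: bij_betw_def orthogonal_def inner_commute)
    then have "orthogonal x x"
      using B(2) orthogonal_to_span[of x B x] by blast
    then show ?thesis by (simp add: orthogonal_def)
  qed
  then have "det P \<noteq> 0"
    using invertible_det_nz[of P] by (metis invertible_left_inverse matrix_left_invertible_ker)
  define C where "C = map_matrix (\<lambda>c. [:c:]) P"
  define M where "M = mat [:0, 1:] - map_matrix (\<lambda>c. [:c:]) Q"
  define c where "c v = (if v \<in> S then [:- l v, 1:] else 1)" for v
  define R :: "real poly^'n^'n" where
    "R = (\<chi> k. if f k \<in> S then \<chi> i. [:f k $ i:] else (C ** transpose M) $ k)"
  have entry: "(C ** transpose M) $ k $ i = [:- ((Q *v f k) $ i), f k $ i:]" for k i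
  proof -
    have "(C ** transpose M) $ k $ i
        = (\<Sum>j\<in>UNIV. (if i = j then [:0, f k $ j:] else 0) - [:f k $ j * Q $ i $ j:])"
      by (auto simp: matrix_matrix_mult_def C_def M_def P_def transpose_def mat_def
          algebra_simps intro!: sum.cong)
    also have "\<dots> = [:0, f k $ i:] - [:(Q *v f k) $ i:]"
      by (simp add: sum_subtractf sum_const_poly matrix_vector_mult_def mult.commute)
    finally show ?thesis by simp
  qed
  have "C ** transpose M = (\<chi> k. c (f k) *s R $ k)"
    by (auto simp: vec_eq_iff entry R_def c_def eig)
  from arg_cong[OF this, of det]
  have "det C * det M = (\<Prod>k\<in>UNIV. c (f k)) * det R"
    unfolding det_mul det_transpose det_rows_mul by simp
  also have "(\<Prod>k\<in>UNIV. c (f k)) = prod c B"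
    using f by (rule prod.reindex_bij_betw)
  also have "prod c B = (\<Prod>v\<in>S. [:- l v, 1:])"
    using prod.mono_neutral_cong_right[OF finB SB, of c] by (auto simp: c_def)
  finally have "smult (det P) (charpoly Q) = (\<Prod>v\<in>S. [:- l v, 1:]) * det R"
    by (simp add: C_def det_const_poly charpoly_def M_def)
  then have "(\<Prod>v\<in>S. [:- l v, 1:]) dvd smult (det P) (charpoly Q)" by simp
  then show ?thesis using \<open>det P \<noteq> 0\<close> by (simp add: dvd_smult_iff)
qed

lemma independent_eigenvectors_card_le_proots:
  fixes Q :: "real^'n^'n"
  assumes "charpoly Q \<noteq> 0" "independent S"
    and eig: "\<And>v. v \<in> S \<Longrightarrow> Q *v v = l v *\<^sub>R v"
    and J: "\<And>v. v \<in> S \<Longrightarrow> J (l v)"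
  shows "card S \<le> size (filter_mset J (proots (charpoly Q)))"
proof -
  let ?p = "\<Prod>v\<in>S. [:- l v, 1:]"
  obtain r where r: "charpoly Q = ?p * r"
    using eigenvalue_prod_dvd_charpoly[OF assms(2) eig] by (auto elim: dvdE)
  have "proots ?p = (\<Sum>v\<in>S. {#l v#})"
    by (subst proots_prod) auto
  also have "\<dots> = image_mset l (mset_set S)"
    by (simp add: sum_unfold_sum_mset)
  finally have p: "proots ?p = image_mset l (mset_set S)" .
  have "proots (charpoly Q) = image_mset l (mset_set S) + proots r"
    using r assms(1) p by (simp add: proots_mult)
  moreover have "filter_mset J (image_mset l (mset_set S)) = image_mset l (mset_set S)"
    using J independent_imp_finite[OF assms(2)] by (auto simp: filter_mset_eq_conv)
  ultimately show ?thesis by simp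
qed

section \<open>Positive definiteness on the complement of the negative eigenvector\<close>

lemma inner_symmetric_matrix_swap:
  fixes Q :: "real^'n^'n"
  assumes "transpose Q = Q"
  shows "x \<bullet> (Q *v y) = y \<bullet> (Q *v x)"
  by (metis dot_lmul_matrix inner_commute assms transpose_matrix_vector)

text \<open>
  The Rayleigh quotient attains its minimum on the unit sphere of the subspace. The residual
  \<open>h = Q *v w - l *\<^sub>R w\<close> at a minimiser \<open>w\<close> lies in the subspace again, and moving from \<open>w\<close> in the
  direction \<open>- h\<close> would decrease the quotient unless \<open>h = 0\<close>.
\<close>

lemma ex_min_eigenvector_on_subspace:
  fixes Q :: "real^'n^'n"
  assumes sym: "transpose Q = Q" and V: "subspace V" "V \<noteq> {0}"
    and inv: "\<And>v. v \<in> V \<Longrightarrow> Q *v v \<in> V"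
  obtains w l where "w \<in> V" "w \<noteq> 0" "Q *v w = l *\<^sub>R w"
    "\<And>v. v \<in> V \<Longrightarrow> l * (v \<bullet> v) \<le> v \<bullet> (Q *v v)"
proof -
  let ?K = "V \<inter> sphere 0 1"
  obtain v0 where v0: "v0 \<in> V" "v0 \<noteq> 0"
    using V subspace_0[OF V(1)] by auto
  have "v0 /\<^sub>R norm v0 \<in> ?K"
    using v0 V(1) by (simp add: subspace_scale)
  then have "?K \<noteq> {}" by blast
  moreover have "compact ?K"
    using closed_subspace[OF V(1)] by (simp add: closed_Int_compact)
  moreover have "continuous_on ?K (\<lambda>v. v \<bullet> (Q *v v))"
    by (intro continuous_intros)
  ultimately obtain w where w: "w \<in> ?K" and wmin: "\<And>v. v \<in> ?K \<Longrightarrow> w \<bullet> (Q *v w) \<le> v \<bullet> (Q *v v)"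
    using continuous_attains_inf[of ?K "\<lambda>v. v \<bullet> (Q *v v)"] by blast
  define l where "l = w \<bullet> (Q *v w)"
  have ww: "w \<bullet> w = 1" "w \<in> V" using w by (auto simp: dot_square_norm)
  have low: "l * (v \<bullet> v) \<le> v \<bullet> (Q *v v)" if "v \<in> V" for v
  proof (cases "v = 0")
    case False
    have "v /\<^sub>R norm v \<in> ?K" using that False V(1) by (simp add: subspace_scale)
    from wmin[OF this] have "l \<le> (v \<bullet> (Q *v v)) / (norm v * norm v)"
      by (simp add: l_def matrix_vector_mult_scaleR divide_inverse mult_ac)
    then show ?thesis using False
      by (simp add: dot_square_norm power2_eq_square field_simps)
  qed simp
  define h where "h = Q *v w - l *\<^sub>R w"
  have hV: "h \<in> V" unfolding h_def using inv ww(2) V(1) by (simp add: subspace_diff subspace_scale)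
  note swap = inner_symmetric_matrix_swap[OF sym, of w h]
  have "h \<bullet> w = 0" by (simp add: h_def inner_diff_left ww l_def inner_commute[of "Q *v w" w])
  then have hh: "h \<bullet> (Q *v w) = h \<bullet> h"
    by (simp add: h_def inner_diff_right)
  define D where "D = h \<bullet> (Q *v h) - l * (h \<bullet> h)"
  \<comment> \<open>Minimality of \<open>l\<close>, expanded along the line \<open>w + t *\<^sub>R h\<close>; the constant term vanishes.\<close>
  have quad: "0 \<le> 2 * t * (h \<bullet> h) + t\<^sup>2 * D" for t
  proof -
    have "w + t *\<^sub>R h \<in> V" using ww hV V(1) by (simp add: subspace_add subspace_scale)
    from low[OF this] show ?thesis
      using \<open>h \<bullet> w = 0\<close> ww swap hh
      by (simp add: D_def matrix_vector_right_distrib matrix_vector_mult_scaleR inner_simps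
          inner_commute l_def[symmetric] power2_eq_square algebra_simps)
  qed
  have "h \<bullet> h \<le> 0"
  proof -
    have "0 \<le> D" using low[OF hV] by (simp add: D_def)
    \<comment> \<open>For \<open>h \<noteq> 0\<close>, a negative \<open>t\<close> small enough for the linear term to dominate; the \<open>+ 1\<close> covers \<open>D = 0\<close>.\<close>
    define t where "t = - (h \<bullet> h) / (D + 1)"
    have "2 * t * (h \<bullet> h) + t\<^sup>2 * D = - (h \<bullet> h)\<^sup>2 * (D + 2) / (D + 1)\<^sup>2"
      using \<open>0 \<le> D\<close> unfolding t_def by (simp add: divide_simps power2_eq_square) (simp add: algebra_simps)
    with quad[of t] have "(h \<bullet> h)\<^sup>2 * (D + 2) / (D + 1)\<^sup>2 \<le> 0" by simp
    then show ?thesis using \<open>0 \<le> D\<close>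
      by (simp add: divide_le_0_iff mult_le_0_iff power2_eq_square zero_le_mult_iff)
  qed
  then have "h = 0" using inner_ge_zero[of h] by (metis inner_eq_zero_iff order_antisym)
  then have "Q *v w = l *\<^sub>R w" by (simp add: h_def)
  then show thesis using that[of w l] ww low by force
qed

lemma pos_def_on_orthogonal_complement:
  fixes Q :: "real^'n^'n"
  assumes sym: "transpose Q = Q" and inertia: "inertia Q = (p, 0, 1)"
    and u: "u \<noteq> 0" "\<mu> < 0" "Q *v u = \<mu> *\<^sub>R u"
    and v: "u \<bullet> v = 0" "v \<noteq> 0"
  shows "0 < v \<bullet> (Q *v v)"
proof -
  note swap = inner_symmetric_matrix_swap[OF sym]
  define V where "V = {v. u \<bullet> v = 0}"
  have V: "subspace V" unfolding V_def by (rule subspace_hyperplane)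
  have "V \<noteq> {0}" using v by (auto simp: V_def)
  have inv: "Q *v x \<in> V" if "x \<in> V" for x
    using that by (simp add: V_def swap[of u x] u inner_commute)
  obtain w l where w: "w \<in> V" "w \<noteq> 0" "Q *v w = l *\<^sub>R w"
    and low: "\<And>v. v \<in> V \<Longrightarrow> l * (v \<bullet> v) \<le> v \<bullet> (Q *v v)"
    using ex_min_eigenvector_on_subspace[OF sym V \<open>V \<noteq> {0}\<close> inv] by blast
  have "0 < l"
  proof (rule ccontr)
    assume "\<not> 0 < l"
    have uw: "u \<noteq> w" "u \<bullet> w = 0" using w u by (auto simp: V_def)
    then have ind: "independent {u, w}"
      using w u by (intro pairwise_orthogonal_independent)
        (auto simp: pairwise_def orthogonal_def inner_commute)
    have nz: "charpoly Q \<noteq> 0" using inertia by (auto simp: inertia_def)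
    define m where "m x = (if x = u then \<mu> else l)" for x
    have "card {u, w} \<le> size (filter_mset (\<lambda>x. x \<le> 0) (proots (charpoly Q)))"
      using w u \<open>\<not> 0 < l\<close>
      by (intro independent_eigenvectors_card_le_proots[OF nz ind, where l = m]) (auto simp: m_def)
    also have "filter_mset (\<lambda>x. x \<le> 0) (proots (charpoly Q))
        = filter_mset (\<lambda>x. x = 0) (proots (charpoly Q)) + filter_mset (\<lambda>x. x < 0) (proots (charpoly Q))"
      by (rule multiset_eqI) auto
    finally have "card {u, w} \<le> 0 + 1"
      using inertia by (simp only: inertia_def prod.inject size_union)
    then show False using uw by simp
  qed
  then have "0 < l * (v \<bullet> v)" using v by simp
  also have "\<dots> \<le> v \<bullet> (Q *v v)" using v by (intro low) (simp add: V_def)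
  finally show ?thesis .
qed

section \<open>The Lorenz cone is a closed convex cone\<close>

lemma closed_lorenz_cone: "closed (lorenz_cone Q u)"
  unfolding lorenz_cone_def
  by (intro closed_Collect_conj closed_Collect_le continuous_intros)

text \<open>
  The second condition in the cone says \<open>0 \<le> x \<bullet> u\<close>, because \<open>Q *v u\<close> is a negative multiple of \<open>u\<close>.
  Everything reduces to \<open>x \<bullet> (Q *v y) \<le> 0\<close> on the cone. The combination
  \<open>(y \<bullet> u) *\<^sub>R x - (x \<bullet> u) *\<^sub>R y\<close> is orthogonal to \<open>u\<close>, so the form is nonnegative on it, whereas it is
  nonpositive on \<open>x\<close> and on \<open>y\<close>; only the mixed term can make up the difference.
\<close>

lemma convex_cone_lorenz_cone:
  fixes Q :: "real^'n^'n"
  assumes sym: "transpose Q = Q" and inertia: "inertia Q = (p, 0, 1)"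
    and u: "u \<noteq> 0" "\<mu> < 0" "Q *v u = \<mu> *\<^sub>R u"
  shows "convex_cone (lorenz_cone Q u)"
proof -
  note pos = pos_def_on_orthogonal_complement[OF assms]
  note swap = inner_symmetric_matrix_swap[OF sym]
  have mem: "x \<in> lorenz_cone Q u \<longleftrightarrow> x \<bullet> (Q *v x) \<le> 0 \<and> 0 \<le> x \<bullet> u" for x
    using u by (auto simp: lorenz_cone_def mult_le_0_iff)
  have cross: "x \<bullet> (Q *v y) \<le> 0" if xy: "x \<in> lorenz_cone Q u" "y \<in> lorenz_cone Q u" for x y
  proof -
    define a b where "a = x \<bullet> u" and "b = y \<bullet> u"
    have ab: "0 \<le> a" "0 \<le> b" using xy by (auto simp: mem a_def b_def)
    define z where "z = b *\<^sub>R x - a *\<^sub>R y"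
    have uz: "u \<bullet> z = 0" by (simp add: z_def a_def b_def inner_simps inner_commute)
    have "0 \<le> z \<bullet> (Q *v z)" using pos[OF uz] by (cases "z = 0") auto
    also have "z \<bullet> (Q *v z) = b\<^sup>2 * (x \<bullet> (Q *v x)) + a\<^sup>2 * (y \<bullet> (Q *v y)) - 2 * (a * b) * (x \<bullet> (Q *v y))"
      by (simp add: z_def inner_simps matrix_vector_mult_diff_distrib matrix_vector_mult_scaleR
          swap[of y x] power2_eq_square algebra_simps)
    finally have ineq: "2 * (a * b) * (x \<bullet> (Q *v y)) \<le> b\<^sup>2 * (x \<bullet> (Q *v x)) + a\<^sup>2 * (y \<bullet> (Q *v y))"
      by simp
    have "b\<^sup>2 * (x \<bullet> (Q *v x)) \<le> 0" "a\<^sup>2 * (y \<bullet> (Q *v y)) \<le> 0"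
      using xy by (auto simp: mem mult_nonneg_nonpos)
    with ineq have le: "(a * b) * (x \<bullet> (Q *v y)) \<le> 0" by linarith
    \<comment> \<open>Only the apex of the cone is orthogonal to \<open>u\<close>, so \<open>a * b\<close> can be cancelled unless \<open>x = 0\<close> or \<open>y = 0\<close>.\<close>
    have zero: "s = 0" if "s \<in> lorenz_cone Q u" "s \<bullet> u = 0" for s
      using that pos[of s] by (force simp: mem inner_commute)
    show ?thesis
    proof (cases "a = 0 \<or> b = 0")
      case True
      then have "x = 0 \<or> y = 0" using zero xy by (auto simp: a_def b_def)
      then show ?thesis by auto
    next
      case False
      then have "0 < a * b" using ab by simp
      then show ?thesis using le by (metis mult_pos_pos not_le)
    qed
  qed
  show ?thesis
    unfolding convex_cone_iff
  proof (intro conjI ballI allI impI)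
    show "0 \<in> lorenz_cone Q u" by (simp add: mem)
  next
    fix x y assume xy: "x \<in> lorenz_cone Q u" "y \<in> lorenz_cone Q u"
    show "x + y \<in> lorenz_cone Q u"
      using xy cross[OF xy] swap[of x y]
      by (auto simp: mem inner_simps matrix_vector_right_distrib)
  next
    fix x and c :: real assume "x \<in> lorenz_cone Q u" "0 \<le> c"
    then show "c *\<^sub>R x \<in> lorenz_cone Q u"
      by (auto simp: mem matrix_vector_mult_scaleR mult_nonneg_nonpos)
  qed
qed

section \<open>Trajectories through a given point\<close>

text \<open>
  The solution is the exponential series \<open>\<Sum>k. t ^ k / fact k *\<^sub>R A ^ k *v p\<close>. It is treated
  componentwise because the theorem on termwise differentiation concerns power series with values
  in a field.
\<close>

lemma ex_linear_ode_solution: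
  fixes A :: "real^'n^'n"
  obtains x where "solves_linear_ode A x" "x 0 = p"
proof -
  define K where "K = onorm ((*v) A)"
  have K: "norm (A *v y) \<le> K * norm y" for y
    unfolding K_def by (rule onorm) simp
  have K0: "0 \<le> K" unfolding K_def by (rule onorm_pos_le) simp
  define a where "a k = ((*v) A ^^ k) p" for k
  have a0: "a 0 = p" and aS: "a (Suc k) = A *v a k" for k by (simp_all add: a_def)
  have a_le: "norm (a k) \<le> K ^ k * norm p" for k
  proof (induction k)
    case (Suc k)
    have "norm (a (Suc k)) \<le> K * norm (a k)" by (simp add: aS K)
    also have "\<dots> \<le> K * (K ^ k * norm p)" using Suc K0 by (rule mult_left_mono)
    finally show ?case by simp
  qed (simp add: a0)
  define c where "c i k = a k $ i / fact k" for i k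
  have sm: "summable (\<lambda>k. c i k * t ^ k)" for i t
  proof (rule summable_comparison_test')
    show "summable (\<lambda>k. norm p * ((K * \<bar>t\<bar>) ^ k / fact k))"
      using summable_exp[of "K * \<bar>t\<bar>"] by (intro summable_mult) (simp add: field_simps)
    show "norm (c i k * t ^ k) \<le> norm p * ((K * \<bar>t\<bar>) ^ k / fact k)" for k
    proof -
      have "\<bar>a k $ i\<bar> \<le> K ^ k * norm p"
        using component_le_norm_cart[of "a k" i] a_le[of k] by simp
      then have "\<bar>a k $ i\<bar> * (\<bar>t\<bar> ^ k / fact k) \<le> K ^ k * norm p * (\<bar>t\<bar> ^ k / fact k)"
        by (intro mult_right_mono) auto
      then show ?thesis by (simp add: c_def abs_mult power_abs power_mult_distrib mult_ac)
    qed
  qed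
  have diffs_c: "diffs (c i) k = (\<Sum>j\<in>UNIV. A $ i $ j * c j k)" for i k
  proof -
    have "diffs (c i) k = (A *v a k) $ i / fact k"
      by (simp add: diffs_def c_def aS field_simps del: of_nat_Suc)
    then show ?thesis by (simp add: matrix_vector_mult_def c_def sum_divide_distrib)
  qed
  define x where "x t = (\<chi> i. \<Sum>k. c i k * t ^ k)" for t
  have "(x has_vector_derivative A *v x t) (at t)" for t
  proof -
    have comp: "((\<lambda>t. x t $ i) has_field_derivative (A *v x t) $ i) (at t)" for i
    proof -
      have "(\<Sum>k. diffs (c i) k * t ^ k) = (\<Sum>k. \<Sum>j\<in>UNIV. A $ i $ j * (c j k * t ^ k))"
        by (simp add: diffs_c sum_distrib_right mult.assoc)
      also have "\<dots> = (\<Sum>j\<in>UNIV. \<Sum>k. A $ i $ j * (c j k * t ^ k))"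
        by (rule suminf_sum) (intro summable_mult sm)
      also have "\<dots> = (A *v x t) $ i"
        by (simp add: matrix_vector_mult_def x_def suminf_mult sm)
      finally show ?thesis
        using termdiffs_strong_converges_everywhere[OF sm, of i t] by (simp add: x_def)
    qed
    then show ?thesis
      unfolding has_vector_derivative_def has_derivative_componentwise_within[of x]
      by (auto simp: Basis_vec_def inner_axis has_field_derivative_def mult_commute_abs)
  qed
  then have "solves_linear_ode A x"
    unfolding solves_linear_ode_def using has_vector_derivative_at_within by blast
  moreover have "x 0 = p"
    by (simp add: x_def vec_eq_iff c_def a0 powser_zero[of "\<lambda>k. a k $ _ / fact k", simplified])
  ultimately show thesis by (rule that)
qed

section \<open>The resolvent preserves an invariant cone\<close>

text \<open>
  At a point \<open>p\<close> where the supporting functional \<open>n\<close> vanishes, the velocity \<open>A *v p\<close> cannot point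
  across the supporting hyperplane, since the trajectory from \<open>p\<close> would leave \<open>C\<close> at once.
\<close>

lemma invariant_imp_cross_nonpos:
  fixes A :: "real^'n^'n"
  assumes inv: "invariant_continuous A C" and "p \<in> C"
    and le: "\<And>z. z \<in> C \<Longrightarrow> n \<bullet> z \<le> 0" and np: "n \<bullet> p = 0"
  shows "n \<bullet> (A *v p) \<le> 0"
proof (rule ccontr)
  assume contr: "\<not> ?thesis"
  obtain x where x: "solves_linear_ode A x" "x 0 = p"
    by (rule ex_linear_ode_solution)
  then have "(x has_vector_derivative A *v p) (at 0 within {0..})"
    by (force simp: solves_linear_ode_def)
  from bounded_linear.has_vector_derivative[OF bounded_linear_inner_right this, of n]
  have "((\<lambda>t. n \<bullet> x t) has_real_derivative n \<bullet> (A *v p)) (at 0 within {0..})"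
    by (simp add: has_real_derivative_iff_has_vector_derivative)
  from has_real_derivative_pos_inc_right[OF this] contr
  obtain d where "d > 0" and d: "\<And>h. h > 0 \<Longrightarrow> h < d \<Longrightarrow> n \<bullet> x 0 < n \<bullet> x h"
    by auto
  have "x (d/2) \<in> C"
    using inv x \<open>p \<in> C\<close> \<open>d > 0\<close> by (auto simp: invariant_continuous_def)
  then show False using le d[of "d/2"] \<open>d > 0\<close> np x(2) by force
qed

text \<open>
  Test the hypothesis against the outer normal \<open>n\<close> at the projection \<open>p\<close> of \<open>y\<close>. The contribution of
  \<open>A *v p\<close> has the favourable sign, and the step size makes that of \<open>A *v n\<close> smaller than \<open>n \<bullet> n\<close>, so
  the implicit step, read backwards, cannot bring a point outside the cone into it.
\<close>

lemma resolvent_preserves_cone: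
  fixes A :: "real^'n^'n"
  assumes C: "convex_cone C" "closed C" and inv: "invariant_continuous A C"
    and dt: "0 \<le> dt" "dt * onorm ((*v) A) < 1"
    and x: "y - dt *\<^sub>R (A *v y) \<in> C"
  shows "y \<in> C"
proof (rule ccontr)
  assume "y \<notin> C"
  have "C \<noteq> {}" "convex C" using C(1) by (auto simp: convex_cone_def)
  define p where "p = closest_point C y"
  define n where "n = y - p"
  have p: "p \<in> C" unfolding p_def using C(2) \<open>C \<noteq> {}\<close> by (rule closest_point_in_set)
  with \<open>y \<notin> C\<close> have "n \<noteq> 0" by (auto simp: n_def)
  have dot: "n \<bullet> (z - p) \<le> 0" if "z \<in> C" for z
    unfolding n_def p_def using \<open>convex C\<close> C(2) that by (rule closest_point_dot)
  have "2 *\<^sub>R p \<in> C" "0 \<in> C"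
    using C(1) p by (auto intro: convex_cone_scaleR convex_cone_contains_0)
  \<comment> \<open>In a cone the projection inequality may be tested at both \<open>0\<close> and \<open>2 *\<^sub>R p\<close>, on either side of \<open>p\<close>.\<close>
  from dot[OF this(1)] dot[OF this(2)] have np: "n \<bullet> p = 0"
    by (simp add: inner_diff_right)
  have le: "n \<bullet> z \<le> 0" if "z \<in> C" for z
    using dot[OF that] np by (simp add: inner_diff_right)
  have nAp: "n \<bullet> (A *v p) \<le> 0"
    using inv p le np by (rule invariant_imp_cross_nonpos)
  have "n \<bullet> (A *v n) \<le> norm n * norm (A *v n)" by (rule norm_cauchy_schwarz)
  also have "\<dots> \<le> norm n * (onorm ((*v) A) * norm n)"
    by (intro mult_left_mono onorm) auto
  finally have nAn: "n \<bullet> (A *v n) \<le> onorm ((*v) A) * (n \<bullet> n)"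
    by (simp add: dot_square_norm power2_eq_square mult_ac)
  have y: "y = p + n" by (simp add: n_def)
  have "n \<bullet> (y - dt *\<^sub>R (A *v y)) = n \<bullet> n - dt * (n \<bullet> (A *v p)) - dt * (n \<bullet> (A *v n))"
    using np by (simp add: y matrix_vector_right_distrib inner_simps algebra_simps)
  moreover have "dt * (n \<bullet> (A *v p)) \<le> 0" using dt(1) nAp by (rule mult_nonneg_nonpos)
  moreover have "dt * (n \<bullet> (A *v n)) \<le> dt * (onorm ((*v) A) * (n \<bullet> n))"
    using nAn dt(1) by (rule mult_left_mono)
  moreover have "dt * onorm ((*v) A) * (n \<bullet> n) < 1 * (n \<bullet> n)"
    using dt(2) \<open>n \<noteq> 0\<close> by (intro mult_strict_right_mono) auto
  moreover have "n \<bullet> (y - dt *\<^sub>R (A *v y)) \<le> 0" using x by (rule le)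
  ultimately show False by (simp add: mult.assoc)
qed

lemma mat_minus_scaleR_mult_vector:
  "(mat 1 - dt *\<^sub>R A) *v y = y - dt *\<^sub>R (A *v y)" for A :: "real^'n^'n"
  by (simp add: matrix_vector_mult_diff_rdistrib scaleR_matrix_vector_assoc)

lemma invertible_mat_minus_scaleR:
  fixes A :: "real^'n^'n"
  assumes dt: "0 \<le> dt" "dt * onorm ((*v) A) < 1"
  shows "invertible (mat 1 - dt *\<^sub>R A)"
proof -
  have "y = 0" if "(mat 1 - dt *\<^sub>R A) *v y = 0" for y
  proof (rule ccontr)
    assume "y \<noteq> 0"
    have "y = dt *\<^sub>R (A *v y)" using that by (simp add: mat_minus_scaleR_mult_vector)
    then have "norm y = dt * norm (A *v y)" using dt(1) by (metis abs_of_nonneg norm_scaleR)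
    also have "\<dots> \<le> dt * (onorm ((*v) A) * norm y)"
      using dt(1) by (intro mult_left_mono onorm) auto
    also have "\<dots> < 1 * norm y"
      using dt(2) \<open>y \<noteq> 0\<close> by (simp add: mult.assoc[symmetric])
    finally show False by simp
  qed
  then show ?thesis
    by (metis invertible_left_inverse matrix_left_invertible_ker)
qed

theorem lemma3p4:
  fixes A Q :: "real^'n^'n" and u xk :: "real^'n" and \<mu> :: real
  assumes "transpose Q = Q"
    and "inertia Q = (CARD('n) - 1, 0, 1)"
    and "u \<noteq> 0" and "\<mu> < 0" and "Q *v u = \<mu> *\<^sub>R u"
    and "invariant_continuous A (lorenz_cone Q u)"
    and "xk \<in> lorenz_cone Q u"
  shows "\<exists>\<tau>>0. \<forall>dt\<in>{0..\<tau>}.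
           invertible (mat 1 - dt *\<^sub>R A) \<and> backward_euler_step A dt xk \<in> lorenz_cone Q u"
proof -
  \<comment> \<open>The step bound is \<open>1 / (K + 1)\<close> and not \<open>1 / K\<close>, which allows \<open>A = 0\<close> and makes \<open>dt * K < 1\<close> strict.\<close>
  define K where "K = onorm ((*v) A)"
  have K: "0 \<le> K" unfolding K_def by (rule onorm_pos_le) simp
  have "invertible (mat 1 - dt *\<^sub>R A) \<and> backward_euler_step A dt xk \<in> lorenz_cone Q u"
    if "dt \<in> {0..1 / (K + 1)}" for dt
  proof -
    have "dt * (K + 1) \<le> 1" using that K by (simp add: field_simps)
    then have "dt * K < 1"
      using that K by (cases "dt = 0") (auto simp: algebra_simps)
    then have dt: "0 \<le> dt" "dt * onorm ((*v) A) < 1" using that by (auto simp: K_def)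
    let ?M = "mat 1 - dt *\<^sub>R A" and ?y = "backward_euler_step A dt xk"
    have inv: "invertible ?M" using dt by (rule invertible_mat_minus_scaleR)
    then have "?M ** matrix_inv ?M = mat 1"
      unfolding matrix_inv_def invertible_def by (rule someI2_ex) simp
    then have "?M *v ?y = xk"
      by (simp add: backward_euler_step_def matrix_vector_mul_assoc)
    then have "?y - dt *\<^sub>R (A *v ?y) \<in> lorenz_cone Q u"
      using assms(7) by (simp add: mat_minus_scaleR_mult_vector)
    then have "?y \<in> lorenz_cone Q u"
      by (rule resolvent_preserves_cone[OF convex_cone_lorenz_cone[OF assms(1-5)]
            closed_lorenz_cone assms(6) dt])
    with inv show ?thesis ..
  qed
  then show ?thesis using K by (intro exI[of _ "1 / (K + 1)"]) auto
qed

end
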